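(* Let $n\ge 1$ and let $\Omega \subset \mathbb{R}^n_{\geq 0}$ be a bounded, convex domain. Let $$ m_{\Omega} = \frac{1}{|\Omega|} \int_{\Omega} \mathbf{x} \, d\mathcal{H}^n(\mathbf{x}) \qquad \text{and} \qquad m_{\partial \Omega} = \frac{1}{|\partial \Omega|} \int_{\partial \Omega} \mathbf{x} \, d\mathcal{H}^{n-1}(\mathbf{x})$$ denote the center of mass of $\Omega$ and the center of mass of $\partial\Omega$, respectively. Then $$ \| m_{\Omega} \| \leq \frac{2 n^{n+1}}{\sqrt{\pi}} \, \| m_{\partial \Omega}\|.$$
   Context: A domain is a nonempty connected open set. $\mathbb{R}^n_{\ge 0} = \{x \in \mathbb{R}^n : x_i \ge 0 \text{ for all } i\}$. $\mathcal{H}^k$ is the $k$-dimensional Hausdorff measure; $|\Omega| = \mathcal{H}^n(\Omega)$ and $|\partial\Omega| = \mathcal{H}^{n-1}(\partial\Omega)$. $\|\cdot\|$ is the Euclidean norm. *)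

theory Defs
  imports "HOL-Analysis.Analysis"
begin

section \<open>Hausdorff measure\<close>

text \<open>
  The factor \<^term>\<open>unit_ball_vol (real k) / 2 ^ k\<close> is the usual normalisation, under which the
  \<^term>\<open>k\<close>-dimensional measure of \<^term>\<open>k\<close>-dimensional Euclidean space is Lebesgue measure.
  For \<^term>\<open>k = 0\<close> the convention \<^term>\<open>0 ^ 0 = 1\<close> gives every nonempty set, in particular every
  singleton, the size 1, so that the 0-dimensional measure is the counting measure; only the
  empty set has to be excepted.
\<close>

definition hausdorff_gauge :: "nat \<Rightarrow> 'a::metric_space set \<Rightarrow> real" where
  "hausdorff_gauge k E =
     (if E = {} then 0 else unit_ball_vol (real k) / 2 ^ k * diameter E ^ k)"

text \<open>
  \<^const>\<open>diameter\<close> is only meaningful on bounded sets, hence the explicit boundedness condition.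
\<close>

definition hausdorff_covers :: "real \<Rightarrow> 'a::metric_space set \<Rightarrow> (nat \<Rightarrow> 'a set) set" where
  "hausdorff_covers \<delta> A =
     {E. A \<subseteq> (\<Union>i. E i) \<and> (\<forall>i. bounded (E i) \<and> diameter (E i) \<le> \<delta>)}"

definition hausdorff_premeasure :: "nat \<Rightarrow> real \<Rightarrow> 'a::metric_space set \<Rightarrow> ennreal" where
  "hausdorff_premeasure k \<delta> A =
     (INF E\<in>hausdorff_covers \<delta> A. \<Sum>i. ennreal (hausdorff_gauge k (E i)))"

definition hausdorff_outer :: "nat \<Rightarrow> 'a::metric_space set \<Rightarrow> ennreal" where
  "hausdorff_outer k A = (SUP \<delta>\<in>{0<..}. hausdorff_premeasure k \<delta> A)"

text \<open>
  \<^const>\<open>measure_of\<close> yields the zero measure unless the given set function is countably additive;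
  the lemma \<open>emeasure_hausdorff_measure\<close> below shows that this default is not taken.
\<close>

definition hausdorff_measure :: "nat \<Rightarrow> 'a::metric_space measure" where
  "hausdorff_measure k = measure_of UNIV (sets borel) (hausdorff_outer k)"


section \<open>Center of mass\<close>

definition center_of_mass :: "nat \<Rightarrow> 'a::euclidean_space set \<Rightarrow> 'a" where
  "center_of_mass k S =
     (1 / measure (hausdorff_measure k) S) *\<^sub>R (LINT x:S|hausdorff_measure k. x)"


section \<open>The Hausdorff measure is a Borel measure\<close>

lemma hausdorff_gauge_mono:
  assumes "A \<subseteq> B" "bounded B"
  shows "hausdorff_gauge k A \<le> hausdorff_gauge k B"
proof (cases "A = {}")
  case True
  then show ?thesis using assms by (simp add: hausdorff_gauge_def diameter_ge_0)
next
  case False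
  have "bounded A" using assms bounded_subset by blast
  then have "diameter A ^ k \<le> diameter B ^ k"
    by (intro power_mono diameter_subset assms diameter_ge_0)
  moreover have "B \<noteq> {}" using assms False by auto
  ultimately show ?thesis
    using False by (simp add: hausdorff_gauge_def mult_left_mono divide_right_mono)
qed

lemma hausdorff_premeasure_le:
  assumes "E \<in> hausdorff_covers \<delta> A"
  shows "hausdorff_premeasure k \<delta> A \<le> (\<Sum>i. ennreal (hausdorff_gauge k (E i)))"
  unfolding hausdorff_premeasure_def using assms by (rule INF_lower)

lemma hausdorff_premeasure_mono:
  "A \<subseteq> B \<Longrightarrow> hausdorff_premeasure k \<delta> A \<le> hausdorff_premeasure k \<delta> B"
  unfolding hausdorff_premeasure_def
  by (rule INF_superset_mono) (auto simp: hausdorff_covers_def)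

lemma hausdorff_premeasure_antimono:
  "\<delta> \<le> \<epsilon> \<Longrightarrow> hausdorff_premeasure k \<epsilon> A \<le> hausdorff_premeasure k \<delta> A"
  unfolding hausdorff_premeasure_def
  by (rule INF_superset_mono) (auto simp: hausdorff_covers_def intro: order_trans)

lemma hausdorff_premeasure_empty:
  assumes "\<delta> > 0"
  shows "hausdorff_premeasure k \<delta> {} = 0"
proof -
  have "(\<lambda>_. {}) \<in> hausdorff_covers \<delta> {}" using assms by (auto simp: hausdorff_covers_def)
  from hausdorff_premeasure_le[OF this] show ?thesis
    by (simp add: hausdorff_gauge_def)
qed

lemma hausdorff_premeasure_subadditive:
  fixes A :: "nat \<Rightarrow> 'a::metric_space set"
  shows "hausdorff_premeasure k \<delta> (\<Union>n. A n) \<le> (\<Sum>n. hausdorff_premeasure k \<delta> (A n))"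
proof (rule ennreal_le_epsilon)
  fix e :: real
  assume e: "0 < e" and fin: "(\<Sum>n. hausdorff_premeasure k \<delta> (A n)) < top"
  let ?\<mu> = "hausdorff_premeasure k \<delta>"
  let ?g = "\<lambda>E. ennreal (hausdorff_gauge k E)"
  have "\<exists>E\<in>hausdorff_covers \<delta> (A n).
      (\<Sum>i. ?g (E i)) \<le> ?\<mu> (A n) + ennreal (e * (1/2) ^ Suc n)" for n
  proof -
    have "?\<mu> (A n) < top"
      using fin by (auto simp: less_top dest!: ennreal_suminf_lessD)
    with e have "?\<mu> (A n) < ?\<mu> (A n) + ennreal (e * (1/2) ^ Suc n)"
      by (auto simp: less_top)
    then show ?thesis
      unfolding hausdorff_premeasure_def INF_less_iff by (blast intro: less_imp_le)
  qed
  then obtain E where E: "\<And>n. E n \<in> hausdorff_covers \<delta> (A n)"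
    and le: "\<And>n. (\<Sum>i. ?g (E n i)) \<le> ?\<mu> (A n) + ennreal (e * (1/2) ^ Suc n)"
    by metis
  define C where "C = case_prod E \<circ> prod_decode"
  have "C \<in> hausdorff_covers \<delta> (\<Union>n. A n)"
  proof -
    have "x \<in> (\<Union>i. C i)" if x: "x \<in> A n" for x n
    proof -
      obtain i where "x \<in> E n i" using E[of n] x unfolding hausdorff_covers_def by blast
      then have "x \<in> C (prod_encode (n, i))" by (simp add: C_def)
      then show ?thesis by blast
    qed
    then show ?thesis using E by (auto simp: hausdorff_covers_def C_def split: prod.split)
  qed
  then have "?\<mu> (\<Union>n. A n) \<le> (\<Sum>i. ?g (C i))" by (rule hausdorff_premeasure_le)
  also have "\<dots> = (\<Sum>n. \<Sum>i. ?g (E n i))"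
    using suminf_ennreal_2dimen[of "\<lambda>n. \<Sum>i. ?g (E n i)" "\<lambda>(n, i). ?g (E n i)"]
    by (simp add: C_def split_def)
  also have "\<dots> \<le> (\<Sum>n. ?\<mu> (A n) + ennreal (e * (1/2) ^ Suc n))"
    by (intro suminf_le le) auto
  also have "\<dots> = (\<Sum>n. ?\<mu> (A n)) + (\<Sum>n. ennreal (e * (1/2) ^ Suc n))"
    by (rule suminf_add[symmetric]) auto
  also have "(\<Sum>n. ennreal (e * (1/2) ^ Suc n)) = ennreal e"
    using e sums_mult[OF power_half_series, of e]
    by (subst suminf_ennreal_eq[where x = e]) auto
  finally show "?\<mu> (\<Union>n. A n) \<le> (\<Sum>n. ?\<mu> (A n)) + ennreal e" .
qed

lemma hausdorff_premeasure_separated: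
  fixes A B :: "'a::metric_space set"
  assumes sep: "\<And>x y. x \<in> A \<Longrightarrow> y \<in> B \<Longrightarrow> \<delta> < dist x y"
  shows "hausdorff_premeasure k \<delta> A + hausdorff_premeasure k \<delta> B
           \<le> hausdorff_premeasure k \<delta> (A \<union> B)"
  unfolding hausdorff_premeasure_def[of k \<delta> "A \<union> B"]
proof (rule INF_greatest)
  fix E assume E: "E \<in> hausdorff_covers \<delta> (A \<union> B)"
  let ?g = "\<lambda>E. ennreal (hausdorff_gauge k E)"
  have bd: "bounded (E i)" and dm: "diameter (E i) \<le> \<delta>" for i
    using E by (auto simp: hausdorff_covers_def)
  have cov: "(\<lambda>i. E i \<inter> X) \<in> hausdorff_covers \<delta> X" if "X \<subseteq> A \<union> B" for X
    using E that order_trans[OF diameter_subset[OF Int_lower1 bd] dm]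
    by (auto simp: hausdorff_covers_def bounded_Int)
  have "?g (E i \<inter> A) + ?g (E i \<inter> B) \<le> ?g (E i)" for i
  proof -
    have "E i \<inter> A = {} \<or> E i \<inter> B = {}"
    proof (rule ccontr)
      assume "\<not> ?thesis"
      then obtain x y where "x \<in> E i" "x \<in> A" "y \<in> E i" "y \<in> B" by auto
      with sep[of x y] diameter_bounded_bound[OF bd[of i], of x y] dm[of i] show False by auto
    qed
    then show ?thesis
      using hausdorff_gauge_mono[OF Int_lower1[of "E i" A] bd, of k]
        hausdorff_gauge_mono[OF Int_lower1[of "E i" B] bd, of k]
      by (auto simp: hausdorff_gauge_def[of k "{}"] ennreal_leI)
  qed
  then have "(\<Sum>i. ?g (E i \<inter> A)) + (\<Sum>i. ?g (E i \<inter> B)) \<le> (\<Sum>i. ?g (E i))"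
    by (subst suminf_add) (auto intro!: suminf_le)
  moreover have "hausdorff_premeasure k \<delta> A + hausdorff_premeasure k \<delta> B
      \<le> (\<Sum>i. ?g (E i \<inter> A)) + (\<Sum>i. ?g (E i \<inter> B))"
    by (intro add_mono hausdorff_premeasure_le cov) auto
  ultimately show "hausdorff_premeasure k \<delta> A + hausdorff_premeasure k \<delta> B \<le> (\<Sum>i. ?g (E i))"
    by (rule order_trans[rotated])
qed

lemma hausdorff_outer_ge: "\<delta> > 0 \<Longrightarrow> hausdorff_premeasure k \<delta> A \<le> hausdorff_outer k A"
  unfolding hausdorff_outer_def by (rule SUP_upper) simp

lemma hausdorff_outer_mono: "A \<subseteq> B \<Longrightarrow> hausdorff_outer k A \<le> hausdorff_outer k B"
  unfolding hausdorff_outer_def by (auto intro!: SUP_mono hausdorff_premeasure_mono)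

lemma hausdorff_outer_empty: "hausdorff_outer k {} = 0"
  unfolding hausdorff_outer_def by (simp add: hausdorff_premeasure_empty)

lemma hausdorff_outer_subadditive:
  "hausdorff_outer k (\<Union>n. A n) \<le> (\<Sum>n. hausdorff_outer k (A n))"
  unfolding hausdorff_outer_def[of k "\<Union>n. A n"]
proof (rule SUP_least)
  fix \<delta> :: real assume "\<delta> \<in> {0<..}"
  then have "(\<Sum>n. hausdorff_premeasure k \<delta> (A n)) \<le> (\<Sum>n. hausdorff_outer k (A n))"
    by (intro suminf_le hausdorff_outer_ge) auto
  then show "hausdorff_premeasure k \<delta> (\<Union>n. A n) \<le> (\<Sum>n. hausdorff_outer k (A n))"
    using hausdorff_premeasure_subadditive order_trans by blast
qed

lemma hausdorff_outer_Un: "hausdorff_outer k (A \<union> B) \<le> hausdorff_outer k A + hausdorff_outer k B"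
proof -
  have "hausdorff_outer k (\<Union>n. binaryset A B n) \<le> (\<Sum>n. hausdorff_outer k (binaryset A B n))"
    by (rule hausdorff_outer_subadditive)
  then show ?thesis
    by (simp add: UN_binaryset_eq suminf_binaryset_eq hausdorff_outer_empty)
qed

lemma outer_measure_space_hausdorff_outer: "outer_measure_space (Pow UNIV) (hausdorff_outer k)"
  using hausdorff_outer_subadditive
  by (auto simp: outer_measure_space_def positive_def increasing_def countably_subadditive_def
      hausdorff_outer_empty intro: hausdorff_outer_mono)

lemma hausdorff_outer_separated:
  fixes A B :: "'a::metric_space set"
  assumes d: "0 < d" and sep: "\<And>x y. x \<in> A \<Longrightarrow> y \<in> B \<Longrightarrow> d \<le> dist x y"
  shows "hausdorff_outer k A + hausdorff_outer k B \<le> hausdorff_outer k (A \<union> B)"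
  unfolding hausdorff_outer_def[of k A] hausdorff_outer_def[of k B]
proof -
  have *: "hausdorff_premeasure k \<delta> A + hausdorff_premeasure k \<epsilon> B \<le> hausdorff_outer k (A \<union> B)"
    if "\<delta> > 0" "\<epsilon> > 0" for \<delta> \<epsilon>
  proof -
    define \<eta> where "\<eta> = min (min \<delta> \<epsilon>) (d / 2)"
    have \<eta>: "\<eta> > 0" "\<eta> \<le> \<delta>" "\<eta> \<le> \<epsilon>" "\<eta> < d" using that d by (auto simp: \<eta>_def)
    have "hausdorff_premeasure k \<delta> A + hausdorff_premeasure k \<epsilon> B
        \<le> hausdorff_premeasure k \<eta> A + hausdorff_premeasure k \<eta> B"
      using \<eta> by (intro add_mono hausdorff_premeasure_antimono)
    also have "\<dots> \<le> hausdorff_premeasure k \<eta> (A \<union> B)"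
      using sep \<eta> by (intro hausdorff_premeasure_separated) force
    also have "\<dots> \<le> hausdorff_outer k (A \<union> B)" using \<eta> by (intro hausdorff_outer_ge)
    finally show ?thesis .
  qed
  have "(SUP \<delta>\<in>{0<..}. hausdorff_premeasure k \<delta> A) + (SUP \<delta>\<in>{0<..}. hausdorff_premeasure k \<delta> B)
      = (SUP \<epsilon>\<in>{0<..}. SUP \<delta>\<in>{0<..}. hausdorff_premeasure k \<delta> A + hausdorff_premeasure k \<epsilon> B)"
    by (simp add: ennreal_SUP_add_left ennreal_SUP_add_right)
  also have "\<dots> \<le> hausdorff_outer k (A \<union> B)"
    using * by (intro SUP_least) auto
  finally show "(SUP \<delta>\<in>{0<..}. hausdorff_premeasure k \<delta> A)
      + (SUP \<delta>\<in>{0<..}. hausdorff_premeasure k \<delta> B) \<le> hausdorff_outer k (A \<union> B)" .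
qed

lemma hausdorff_outer_separated_infdist:
  fixes A B :: "'a::metric_space set"
  assumes "a < b" "\<And>x. x \<in> A \<Longrightarrow> infdist x C \<le> a" "\<And>y. y \<in> B \<Longrightarrow> b \<le> infdist y C"
  shows "hausdorff_outer k A + hausdorff_outer k B \<le> hausdorff_outer k (A \<union> B)"
proof (rule hausdorff_outer_separated)
  show "0 < b - a" using assms by simp
  show "b - a \<le> dist x y" if "x \<in> A" "y \<in> B" for x y
    using assms(2)[OF that(1)] assms(3)[OF that(2)] infdist_triangle[of y C x]
    by (simp add: dist_commute)
qed

text \<open>Caratheodory's criterion: a metric outer measure makes all closed sets measurable.\<close>

lemma hausdorff_outer_closed_split:
  fixes C A :: "'a::metric_space set"
  assumes "closed C" "C \<noteq> {}"
  shows "hausdorff_outer k (A \<inter> C) + hausdorff_outer k (A - C) \<le> hausdorff_outer k A"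
proof (cases "hausdorff_outer k A = top")
  case True
  then show ?thesis by simp
next
  case False
  let ?\<mu> = "hausdorff_outer k :: 'a set \<Rightarrow> ennreal"
  define r where "r j = 1 / real (Suc j)" for j
  have r: "r j > 0" "r (Suc j) < r j" for j by (auto simp: r_def field_simps)
  have r_le: "r j \<le> r i" if "i \<le> j" for i j using that by (auto simp: r_def field_simps)
  define B where "B j = {x\<in>A. r j \<le> infdist x C}" for j
  define R where "R j = {x\<in>A. r (Suc j) \<le> infdist x C \<and> infdist x C < r j}" for j
  have cover: "A - C \<subseteq> B j \<union> (\<Union>i. R (i + j))" for j
  proof
    fix x assume x: "x \<in> A - C"
    then have "0 < infdist x C" using assms infdist_pos_not_in_closed by blast
    then obtain m where m: "r m < infdist x C"
      using reals_Archimedean[of "infdist x C"] by (auto simp: r_def inverse_eq_divide)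
    show "x \<in> B j \<union> (\<Union>i. R (i + j))"
    proof (cases "r j \<le> infdist x C")
      case True
      then have "x \<in> B j" using x by (simp add: B_def)
      then show ?thesis by (rule UnI1)
    next
      case False
      define l where "l = (LEAST l. r l \<le> infdist x C)"
      have l: "r l \<le> infdist x C" unfolding l_def by (rule LeastI[of _ m]) (use m in simp)
      have "j < l"
      proof (rule ccontr)
        assume "\<not> j < l"
        then have "r j \<le> r l" by (intro r_le) simp
        then show False using l False by simp
      qed
      define p where "p = l - 1"
      have p: "l = Suc p" "j \<le> p" using \<open>j < l\<close> by (auto simp: p_def)
      have "p < (LEAST l. r l \<le> infdist x C)" using p(1) by (simp flip: l_def)
      then have "\<not> r p \<le> infdist x C" by (rule not_less_Least)
      then have "x \<in> R ((p - j) + j)" using l p x by (simp add: R_def)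
      then show ?thesis by (intro UnI2 UN_I UNIV_I)
    qed
  qed
  have par: "(\<Sum>i<m. ?\<mu> (R (2 * i + q))) \<le> ?\<mu> (\<Union>i<m. R (2 * i + q))" for m q
  proof (induction m)
    case 0
    then show ?case by simp
  next
    case (Suc m)
    have "(\<Sum>i<Suc m. ?\<mu> (R (2 * i + q))) \<le> ?\<mu> (R (2 * m + q)) + ?\<mu> (\<Union>i<m. R (2 * i + q))"
      using Suc by (simp add: add.commute add_left_mono)
    also have "\<dots> \<le> ?\<mu> (R (2 * m + q) \<union> (\<Union>i<m. R (2 * i + q)))"
    proof (cases "m = 0")
      case True
      then show ?thesis by (simp add: hausdorff_outer_empty)
    next
      case False
      show ?thesis
      proof (rule hausdorff_outer_separated_infdist)
        show "r (2 * m + q) < r (2 * m + q - 1)" using r(2)[of "2 * m + q - 1"] False by simp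
        show "infdist x C \<le> r (2 * m + q)" if "x \<in> R (2 * m + q)" for x
          using that by (auto simp: R_def)
        show "r (2 * m + q - 1) \<le> infdist y C" if "y \<in> (\<Union>i<m. R (2 * i + q))" for y
        proof -
          from that obtain i where "i < m" "r (Suc (2 * i + q)) \<le> infdist y C"
            by (auto simp: R_def)
          then show ?thesis using r_le[of "Suc (2 * i + q)" "2 * m + q - 1"] by linarith
        qed
      qed
    qed
    finally show ?case by (simp add: lessThan_Suc)
  qed
  have par_sum: "(\<Sum>i. ?\<mu> (R (2 * i + q))) \<le> ?\<mu> A" for q
    by (intro suminf_le_const summableI order_trans[OF par] hausdorff_outer_mono)
      (auto simp: R_def)
  have "(\<Sum>i<j. ?\<mu> (R i)) \<le> ?\<mu> A + ?\<mu> A" for j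
  proof -
    have "(\<Sum>i<j. ?\<mu> (R i)) \<le> (\<Sum>i<2*j. ?\<mu> (R i))" by (intro sum_mono2) auto
    also have "\<dots> = (\<Sum>i<j. ?\<mu> (R (2 * i + 0))) + (\<Sum>i<j. ?\<mu> (R (2 * i + 1)))"
      by (induction j) (auto simp: ac_simps)
    also have "\<dots> \<le> ?\<mu> A + ?\<mu> A"
      by (intro add_mono order_trans[OF sum_le_suminf par_sum]) auto
    finally show ?thesis .
  qed
  then have "(\<Sum>i. ?\<mu> (R i)) \<le> ?\<mu> A + ?\<mu> A" by (intro suminf_le_const) auto
  then have fin: "(\<Sum>i. ?\<mu> (R i)) \<noteq> top" using False
    by (auto simp: top_unique)
  have step: "?\<mu> (A \<inter> C) + ?\<mu> (A - C) + (\<Sum>i<j. ?\<mu> (R i)) \<le> ?\<mu> A + (\<Sum>i. ?\<mu> (R i))" for j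
  proof -
    have "?\<mu> (A - C) \<le> ?\<mu> (B j \<union> (\<Union>i. R (i + j)))"
      by (rule hausdorff_outer_mono[OF cover])
    also have "\<dots> \<le> ?\<mu> (B j) + ?\<mu> (\<Union>i. R (i + j))"
      by (rule hausdorff_outer_Un)
    also have "\<dots> \<le> ?\<mu> (B j) + (\<Sum>i. ?\<mu> (R (i + j)))"
      by (intro add_left_mono hausdorff_outer_subadditive)
    finally have "?\<mu> (A \<inter> C) + ?\<mu> (A - C)
        \<le> ?\<mu> (A \<inter> C) + (?\<mu> (B j) + (\<Sum>i. ?\<mu> (R (i + j))))"
      by (rule add_left_mono)
    also have "\<dots> = (?\<mu> (A \<inter> C) + ?\<mu> (B j)) + (\<Sum>i. ?\<mu> (R (i + j)))"
      by (rule add.assoc[symmetric])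
    also have "\<dots> \<le> ?\<mu> (A \<inter> C \<union> B j) + (\<Sum>i. ?\<mu> (R (i + j)))"
      by (intro add_right_mono hausdorff_outer_separated_infdist[of 0 "r j" _ C])
        (auto simp: r B_def)
    also have "\<dots> \<le> ?\<mu> A + (\<Sum>i. ?\<mu> (R (i + j)))"
      by (intro add_right_mono hausdorff_outer_mono) (auto simp: B_def)
    finally have "?\<mu> (A \<inter> C) + ?\<mu> (A - C) \<le> ?\<mu> A + (\<Sum>i. ?\<mu> (R (i + j)))" .
    then have "?\<mu> (A \<inter> C) + ?\<mu> (A - C) + (\<Sum>i<j. ?\<mu> (R i))
        \<le> ?\<mu> A + ((\<Sum>i. ?\<mu> (R (i + j))) + (\<Sum>i<j. ?\<mu> (R i)))"
      by (simp add: add_right_mono add.assoc[symmetric])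
    then show ?thesis by (simp add: suminf_offset[of "\<lambda>i. ?\<mu> (R i)" j] add.commute)
  qed
  have "?\<mu> (A \<inter> C) + ?\<mu> (A - C) + (\<Sum>i. ?\<mu> (R i)) \<le> ?\<mu> A + (\<Sum>i. ?\<mu> (R i))"
    by (rule LIMSEQ_le_const2[OF tendsto_add[OF tendsto_const summable_LIMSEQ]])
      (use step in auto)
  then show ?thesis using fin by (simp add: ennreal_add_left_cancel_le add.commute[of _ "\<Sum>i. ?\<mu> (R i)"])
qed

lemma closed_in_lambda_system_hausdorff_outer:
  assumes "closed C"
  shows "C \<in> lambda_system UNIV (Pow UNIV) (hausdorff_outer k)"
proof -
  have "hausdorff_outer k (A \<inter> C) + hausdorff_outer k (A - C) = hausdorff_outer k A" for A
  proof (cases "C = {}")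
    case True
    then show ?thesis by (simp add: hausdorff_outer_empty)
  next
    case False
    have "A \<inter> C \<union> (A - C) = A" by blast
    then show ?thesis
      using hausdorff_outer_closed_split[OF assms False, of k A]
        hausdorff_outer_Un[of k "A \<inter> C" "A - C"] by (simp add: antisym)
  qed
  then show ?thesis
    using algebra.lambda_system_eq[OF sigma_algebra.axioms(1)[OF sigma_algebra_Pow[of UNIV]]] by auto
qed

lemma measure_space_hausdorff_outer:
  "measure_space UNIV (sets (borel :: 'a::metric_space measure)) (hausdorff_outer k)"
proof -
  let ?L = "lambda_system UNIV (Pow UNIV) (hausdorff_outer k :: 'a set \<Rightarrow> ennreal)"
  interpret P: sigma_algebra UNIV "Pow UNIV :: 'a set set" by (rule sigma_algebra_Pow)
  have L: "measure_space UNIV ?L (hausdorff_outer k)"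
    by (rule P.caratheodory_lemma[OF outer_measure_space_hausdorff_outer])
  then interpret L: sigma_algebra UNIV ?L by (simp add: measure_space_def)
  have sub: "sets (borel :: 'a measure) \<subseteq> ?L"
    unfolding borel_eq_closed
    by (subst sets_measure_of)
      (auto intro!: L.sigma_sets_subset closed_in_lambda_system_hausdorff_outer simp del: Pow_UNIV)
  show ?thesis
    using L sub sets.sigma_algebra_axioms[of "borel :: 'a measure"]
    by (auto simp: measure_space_def positive_def countably_additive_def)
qed

lemma space_hausdorff_measure [simp]: "space (hausdorff_measure k) = UNIV"
  by (simp add: hausdorff_measure_def space_measure_of_conv)

lemma sets_hausdorff_measure [simp, measurable_cong]: "sets (hausdorff_measure k) = sets borel"
  unfolding hausdorff_measure_def
  by (metis sets.sigma_sets_eq sets_measure_of space_borel subset_UNIV Pow_UNIV)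

lemma emeasure_hausdorff_measure:
  assumes "A \<in> sets borel"
  shows "emeasure (hausdorff_measure k) A = hausdorff_outer k A"
  using measure_space_hausdorff_outer[of k] assms
  unfolding hausdorff_measure_def measure_space_def
  by (intro emeasure_measure_of_sigma) auto

end

theory Submission
  imports Defs
begin

text \<open>
  Let \<open>k = n - 1\<close> and let \<open>u\<close> be a coordinate direction. The inequality is proved for each
  coordinate separately, in the form \<open>B \<le> C * (center_of_mass k (frontier \<Omega>) \<bullet> u)\<close>, where
  \<open>B\<close> is the maximum of \<open>x \<bullet> u\<close> over \<open>closure \<Omega>\<close>; the center of mass of \<open>\<Omega>\<close> itself has
  \<open>u\<close>-coordinate at most \<open>B\<close>, whatever the measure.

  The boundary cannot avoid the region where \<open>x \<bullet> u\<close> is of size \<open>B\<close>. Let \<open>p\<close> be a highest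
  point and contract \<open>closure \<Omega>\<close> towards \<open>p\<close> by a factor \<open>t\<close>. The contracted body \<open>A\<close> lies in
  \<open>closure \<Omega>\<close> by convexity, and above the height \<open>s = (1 - t) * B\<close> because \<open>x \<bullet> u \<ge> 0\<close>; its
  boundary has measure \<open>t ^ k\<close> times that of \<open>frontier \<Omega>\<close>. Nearest-point projection onto \<open>A\<close>
  does not increase Hausdorff measure, and already the cap \<open>frontier \<Omega> \<inter> {x. s \<le> x \<bullet> u}\<close>
  together with its orthogonal shadow on the hyperplane at height \<open>s\<close> is projected onto the
  whole boundary of \<open>A\<close>. So the cap has at least the fraction \<open>t ^ k / 2\<close> of the measure of
  \<open>frontier \<Omega>\<close> (\<open>hausdorff_outer_frontier_le_cap\<close>), and by Markov's inequality
  \<open>(1 - t) * t ^ k / 2 * B \<le> center_of_mass k (frontier \<Omega>) \<bullet> u\<close>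
  (\<open>center_of_mass_component_le\<close>). For \<open>n \<ge> 2\<close> the choice \<open>t = k / n\<close> gives a constant
  \<open>C\<close> below the required one (\<open>cap_constant\<close>).

  For \<open>n = 1\<close> the required constant \<open>2 / sqrt pi\<close> is too small for this estimate, but then \<open>\<Omega>\<close>
  is an interval, and it and its boundary are invariant under reflection in the midpoint, which
  is therefore the center of mass of both (\<open>center_of_mass_domain_1dim\<close>).

  Dividing by the measure of the boundary requires it to be finite and positive. It is
  finite because \<open>frontier \<Omega>\<close> is the nearest-point image of the boundary of a surrounding cube,
  whose faces are covered by grids (\<open>hausdorff_outer_frontier_finite\<close>), and positive because a
  covering of \<open>frontier \<Omega>\<close> by small sets yields a covering of \<open>\<Omega>\<close> by thin boxes
  (\<open>hausdorff_outer_frontier_pos\<close>).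
\<close>

section \<open>Hausdorff measure of Lipschitz images\<close>

lemma hausdorff_gauge_nonneg: "bounded E \<Longrightarrow> 0 \<le> hausdorff_gauge k E"
  by (simp add: hausdorff_gauge_def diameter_ge_0)

lemma diameter_lipschitz_image:
  fixes f :: "'a::metric_space \<Rightarrow> 'b::metric_space"
  assumes "bounded E" "0 \<le> L" and lip: "\<And>x y. x \<in> E \<Longrightarrow> y \<in> E \<Longrightarrow> dist (f x) (f y) \<le> L * dist x y"
  shows "bounded (f ` E)" and "diameter (f ` E) \<le> L * diameter E"
proof -
  have le: "dist (f x) (f y) \<le> L * diameter E" if "x \<in> E" "y \<in> E" for x y
    using lip[OF that] mult_left_mono[OF diameter_bounded_bound[OF \<open>bounded E\<close> that] \<open>0 \<le> L\<close>]
    by linarith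
  show "bounded (f ` E)"
    using le unfolding bounded_two_points by blast
  show "diameter (f ` E) \<le> L * diameter E"
    using le diameter_ge_0[OF \<open>bounded E\<close>] \<open>0 \<le> L\<close>
    unfolding diameter_def[of "f ` E"] by (auto intro!: cSUP_least)
qed

lemma hausdorff_outer_lipschitz_image:
  fixes f :: "'a::metric_space \<Rightarrow> 'b::metric_space"
  assumes L: "0 < L" and lip: "\<And>x y. x \<in> A \<Longrightarrow> y \<in> A \<Longrightarrow> dist (f x) (f y) \<le> L * dist x y"
  shows "hausdorff_outer k (f ` A) \<le> ennreal (L ^ k) * hausdorff_outer k A"
  unfolding hausdorff_outer_def[of k "f ` A"]
proof (rule SUP_least)
  fix \<delta> :: real assume "\<delta> \<in> {0<..}"
  then have \<delta>: "0 < \<delta>" by simp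
  let ?c = "ennreal (L ^ k)"
  have c: "?c \<noteq> 0" "?c \<noteq> top" using L by (auto simp: not_le)
  have "hausdorff_premeasure k \<delta> (f ` A) / ?c \<le> hausdorff_premeasure k (\<delta> / L) A"
    unfolding hausdorff_premeasure_def[of k "\<delta> / L" A]
  proof (rule INF_greatest)
    fix E assume E: "E \<in> hausdorff_covers (\<delta> / L) A"
    then have bd: "bounded (E i)" and dm: "diameter (E i) \<le> \<delta> / L" for i
      by (auto simp: hausdorff_covers_def)
    \<comment> \<open>The map is controlled only on \<open>A\<close>, so the covering sets are cut down to \<open>A\<close> first.\<close>
    define F where "F i = f ` (E i \<inter> A)" for i
    have bdI: "bounded (E i \<inter> A)" for i using bd by (simp add: bounded_Int)
    have F: "bounded (F i)" "diameter (F i) \<le> L * diameter (E i)" for i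
    proof -
      have *: "bounded (F i) \<and> diameter (F i) \<le> L * diameter (E i \<inter> A)"
        unfolding F_def using diameter_lipschitz_image[OF bdI, of L _ f] L lip by auto
      have "L * diameter (E i \<inter> A) \<le> L * diameter (E i)"
        using L by (intro mult_left_mono diameter_subset bd) auto
      with * show "bounded (F i)" "diameter (F i) \<le> L * diameter (E i)" by auto
    qed
    have "diameter (F i) \<le> \<delta>" for i
      using F(2)[of i] dm[of i] L by (simp add: field_simps)
    moreover have "f ` A \<subseteq> (\<Union>i. F i)" using E by (fastforce simp: hausdorff_covers_def F_def)
    ultimately have "F \<in> hausdorff_covers \<delta> (f ` A)" using F by (simp add: hausdorff_covers_def)
    then have "hausdorff_premeasure k \<delta> (f ` A) \<le> (\<Sum>i. ennreal (hausdorff_gauge k (F i)))"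
      by (rule hausdorff_premeasure_le)
    also have "\<dots> \<le> (\<Sum>i. ennreal (hausdorff_gauge k (E i)) * ?c)"
    proof (intro suminf_le summableI)
      fix i
      have "diameter (F i) ^ k \<le> (L * diameter (E i)) ^ k"
        using F by (intro power_mono diameter_ge_0)
      then have "unit_ball_vol (real k) / 2 ^ k * diameter (F i) ^ k
          \<le> unit_ball_vol (real k) / 2 ^ k * (L * diameter (E i)) ^ k"
        by (rule mult_left_mono) simp
      then have "hausdorff_gauge k (F i) \<le> hausdorff_gauge k (E i) * L ^ k"
        using hausdorff_gauge_nonneg[OF bd, of k i] L
        by (auto simp: hausdorff_gauge_def F_def power_mult_distrib mult_ac)
      then show "ennreal (hausdorff_gauge k (F i)) \<le> ennreal (hausdorff_gauge k (E i)) * ?c"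
        using L hausdorff_gauge_nonneg[OF bd] by (simp add: ennreal_leI flip: ennreal_mult)
    qed
    also have "\<dots> = (\<Sum>i. ennreal (hausdorff_gauge k (E i))) * ?c"
      by simp
    finally show "hausdorff_premeasure k \<delta> (f ` A) / ?c \<le> (\<Sum>i. ennreal (hausdorff_gauge k (E i)))"
      using c by (intro divide_le_posI_ennreal) (auto simp: zero_less_iff_neq_zero mult.commute)
  qed
  also have "\<dots> \<le> hausdorff_outer k A" using \<delta> L by (intro hausdorff_outer_ge) simp
  finally have "hausdorff_premeasure k \<delta> (f ` A) / ?c * ?c \<le> hausdorff_outer k A * ?c"
    by (rule mult_right_mono) simp
  then show "hausdorff_premeasure k \<delta> (f ` A) \<le> ?c * hausdorff_outer k A"
    using c by (simp add: mult.commute[of _ ?c] ennreal_times_divide)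
      (simp add: mult.commute[of ?c] mult_divide_eq_ennreal)
qed

section \<open>Projecting outer boundaries onto inner ones\<close>

lemma closest_point_normal:
  fixes S :: "'a::euclidean_space set"
  assumes S: "convex S" "closed S" "y \<in> S" and a: "\<And>x. x \<in> S \<Longrightarrow> a \<bullet> x \<le> a \<bullet> y" and r: "0 \<le> r"
  shows "closest_point S (y + r *\<^sub>R a) = y"
proof (rule closest_point_unique[symmetric, OF S])
  show "\<forall>z\<in>S. dist (y + r *\<^sub>R a) y \<le> dist (y + r *\<^sub>R a) z"
  proof
    fix z assume z: "z \<in> S"
    have "0 \<le> r * (a \<bullet> y - a \<bullet> z)" using a[OF z] r by simp
    moreover have "(norm (y + r *\<^sub>R a - z))\<^sup>2 = (norm (r *\<^sub>R a))\<^sup>2 + 2 * (r * (a \<bullet> y - a \<bullet> z)) + (norm (y - z))\<^sup>2"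
      unfolding power2_norm_eq_inner by (simp add: algebra_simps inner_commute)
    ultimately have "(norm (r *\<^sub>R a))\<^sup>2 \<le> (norm (y + r *\<^sub>R a - z))\<^sup>2" by simp
    then have "norm (r *\<^sub>R a) \<le> norm (y + r *\<^sub>R a - z)" by (rule power2_le_imp_le) simp
    then show "dist (y + r *\<^sub>R a) y \<le> dist (y + r *\<^sub>R a) z" by (simp add: dist_norm)
  qed
qed

lemma ray_meets_frontier:
  fixes D :: "'a::real_normed_vector set"
  assumes "bounded D" "y \<in> D" "a \<noteq> 0"
  obtains r where "0 \<le> r" "y + r *\<^sub>R a \<in> frontier D"
proof -
  let ?R = "(\<lambda>r. y + r *\<^sub>R a) ` {0..}"
  have "connected ?R"
    by (intro connected_continuous_image continuous_intros convex_connected) auto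
  moreover have "?R \<inter> D \<noteq> {}" using assms(2) by (auto intro!: image_eqI[of _ _ 0])
  moreover have "?R - D \<noteq> {}"
  proof -
    obtain B where B: "\<And>x. x \<in> D \<Longrightarrow> norm x \<le> B" "0 < B"
      using assms(1) bounded_pos by blast
    let ?r = "(B + norm y + 1) / norm a"
    have "norm (?r *\<^sub>R a) \<le> norm (y + ?r *\<^sub>R a) + norm y"
      using norm_triangle_ineq4[of "y + ?r *\<^sub>R a" y] by (simp only: add_diff_cancel_left')
    moreover have "norm (?r *\<^sub>R a) = B + norm y + 1" using assms(3) B(2) by simp
    ultimately have "y + ?r *\<^sub>R a \<notin> D" using B(1)[of "y + ?r *\<^sub>R a"] by linarith
    moreover have "0 \<le> ?r" using B(2) by simp
    ultimately show ?thesis by blast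
  qed
  ultimately have "?R \<inter> frontier D \<noteq> {}" by (rule connected_Int_frontier)
  then show ?thesis using that by auto
qed

lemma frontier_normal:
  fixes S :: "'a::euclidean_space set"
  assumes "convex S" "closed S" "y \<in> frontier S" "interior S \<noteq> {}"
  obtains a where "a \<noteq> 0" "\<And>x. x \<in> S \<Longrightarrow> a \<bullet> x \<le> a \<bullet> y"
proof -
  have "y \<in> closure S" "y \<notin> rel_interior S"
    using assms by (auto simp: frontier_def rel_interior_nonempty_interior)
  then obtain a where "a \<noteq> 0" "\<And>x. x \<in> closure S \<Longrightarrow> a \<bullet> y \<le> a \<bullet> x"
    using supporting_hyperplane_relative_frontier[OF assms(1)] by metis
  then show ?thesis using that[of "- a"] assms(2) by simp
qed

text \<open>
  Moving outwards from a boundary point \<open>y\<close> of \<open>S\<close> along an outer normal does not change the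
  nearest point of \<open>S\<close>, which stays \<open>y\<close>, and eventually crosses the boundary of \<open>D\<close>.
\<close>
lemma frontier_subset_closest_point_image:
  fixes S :: "'a::euclidean_space set"
  assumes "convex S" "closed S" "interior S \<noteq> {}" "bounded D" "S \<subseteq> D"
  shows "frontier S \<subseteq> closest_point S ` frontier D"
proof
  fix y assume y: "y \<in> frontier S"
  then have yS: "y \<in> S" using assms(2) by (auto simp: frontier_def)
  obtain a where a: "a \<noteq> 0" "\<And>x. x \<in> S \<Longrightarrow> a \<bullet> x \<le> a \<bullet> y"
    using frontier_normal[OF assms(1,2) y assms(3)] by metis
  obtain r where r: "0 \<le> r" "y + r *\<^sub>R a \<in> frontier D"
    using ray_meets_frontier[OF assms(4) _ a(1)] yS assms(5) by blast
  show "y \<in> closest_point S ` frontier D"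
    using closest_point_normal[OF assms(1,2) yS a(2) r(1)] r(2) by (metis imageI)
qed

lemma hausdorff_outer_frontier_mono:
  fixes S :: "'a::euclidean_space set"
  assumes "convex S" "closed S" "interior S \<noteq> {}" "bounded D" "S \<subseteq> D"
  shows "hausdorff_outer k (frontier S) \<le> hausdorff_outer k (frontier D)"
proof -
  have "S \<noteq> {}" using assms(3) by auto
  have "hausdorff_outer k (frontier S) \<le> hausdorff_outer k (closest_point S ` frontier D)"
    by (intro hausdorff_outer_mono frontier_subset_closest_point_image assms)
  also have "\<dots> \<le> ennreal (1 ^ k) * hausdorff_outer k (frontier D)"
    by (rule hausdorff_outer_lipschitz_image)
      (use closest_point_lipschitz[OF assms(1,2) \<open>S \<noteq> {}\<close>] in auto)
  finally show ?thesis by simp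
qed

section \<open>The boundary of a convex body has finite measure\<close>

lemma hausdorff_premeasure_le_finite:
  assumes "finite I" "A \<subseteq> (\<Union>i\<in>I. E i)" "0 \<le> \<delta>"
    and "\<And>i. i \<in> I \<Longrightarrow> bounded (E i)" "\<And>i. i \<in> I \<Longrightarrow> diameter (E i) \<le> \<delta>"
  shows "hausdorff_premeasure k \<delta> A \<le> (\<Sum>i\<in>I. ennreal (hausdorff_gauge k (E i)))"
proof -
  obtain e where e: "bij_betw e {0..<card I} I"
    using ex_bij_betw_nat_finite[OF assms(1)] by blast
  define F where "F i = (if i < card I then E (e i) else {})" for i
  have eI: "e i \<in> I" if "i < card I" for i
    using bij_betwE[OF e] that by simp
  have "A \<subseteq> (\<Union>i. F i)"
  proof
    fix x assume "x \<in> A"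
    then obtain i where i: "i \<in> I" "x \<in> E i" using assms(2) by blast
    then obtain m where "m < card I" "e m = i"
      using bij_betw_imp_surj_on[OF e] by (metis imageE atLeastLessThan_iff)
    with i have "x \<in> F m" by (simp add: F_def)
    then show "x \<in> (\<Union>i. F i)" by blast
  qed
  then have "F \<in> hausdorff_covers \<delta> A"
    using assms(3,4,5) eI by (auto simp: hausdorff_covers_def F_def)
  then have "hausdorff_premeasure k \<delta> A \<le> (\<Sum>i. ennreal (hausdorff_gauge k (F i)))"
    by (rule hausdorff_premeasure_le)
  also have "\<dots> = (\<Sum>i\<in>{0..<card I}. ennreal (hausdorff_gauge k (F i)))"
    by (rule suminf_finite) (auto simp: F_def hausdorff_gauge_def)
  also have "\<dots> = (\<Sum>i\<in>{0..<card I}. ennreal (hausdorff_gauge k (E (e i))))"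
    by (intro sum.cong) (auto simp: F_def)
  also have "\<dots> = (\<Sum>i\<in>I. ennreal (hausdorff_gauge k (E i)))"
    by (rule sum.reindex_bij_betw[OF e])
  finally show ?thesis .
qed

lemma grid_index:
  assumes "0 < N" "0 \<le> t" "t \<le> real N"
  obtains m where "m < N" "real m \<le> t" "t \<le> real m + 1"
proof (cases "t = real N")
  case True
  then show ?thesis using that[of "N - 1"] assms by (simp add: of_nat_diff)
next
  case False
  then show ?thesis using that[of "nat \<lfloor>t\<rfloor>"] assms by (simp add: nat_less_iff floor_less_iff)
qed

text \<open>
  With \<open>N\<close> subdivisions per edge, the \<open>2 n\<close> faces fall into \<open>2 n N ^ (n - 1)\<close> cells of diameter
  proportional to \<open>1 / N\<close>, so that the sum of their \<open>(n - 1)\<close>-dimensional gauges does not depend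
  on \<open>N\<close>.
\<close>
lemma hausdorff_outer_frontier_cube:
  assumes L: "0 < L"
  shows "hausdorff_outer (DIM('a) - 1)
    (frontier (cbox (- (L *\<^sub>R One)) (L *\<^sub>R One) :: 'a::euclidean_space set)) < top"
proof -
  let ?k = "DIM('a) - 1" and ?n = "real DIM('a)"
  let ?D = "cbox (- (L *\<^sub>R One)) (L *\<^sub>R One) :: 'a set"
  define v where "v = unit_ball_vol (real ?k) / 2 ^ ?k"
  have v: "0 \<le> v" by (simp add: v_def)
  have gauge: "hausdorff_gauge ?k X = (if X = {} then 0 else v * diameter X ^ ?k)" for X :: "'a set"
    by (simp only: hausdorff_gauge_def v_def)
  define C where "C = ennreal (2 * ?n * v * (?n * (2 * L)) ^ ?k)"
  have "hausdorff_premeasure ?k \<delta> (frontier ?D) \<le> C" if \<delta>: "0 < \<delta>" for \<delta>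
  proof -
    obtain N :: nat where N: "?n * (2 * L) / \<delta> < real N" using reals_Archimedean2 by blast
    have "0 \<le> ?n * (2 * L) / \<delta>" using L \<delta> by simp
    then have N0: "0 < real N" using N by linarith
    define h where "h = 2 * L / real N"
    have h: "0 < h" using L N0 by (simp add: h_def)
    have h\<delta>: "?n * h \<le> \<delta>" using N N0 \<delta> by (simp add: h_def field_simps)
    \<comment> \<open>A cell \<open>(b, s, g)\<close> lies in the face \<open>x \<bullet> b = s\<close>; \<open>g\<close> holds its grid position in the other directions.\<close>
    define I where "I = (SIGMA b:(Basis :: 'a set). {L, - L} \<times> ((Basis - {b}) \<rightarrow>\<^sub>E {..<N}))"
    define E where "E = (\<lambda>(b :: 'a, s, g). {x. x \<bullet> b = s \<and>
      (\<forall>c\<in>Basis - {b}. real (g c) * h - L \<le> x \<bullet> c \<and> x \<bullet> c \<le> (real (g c) + 1) * h - L)})"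
    have finI: "finite I" unfolding I_def by (intro finite_SigmaI finite_cartesian_product finite_PiE) auto
    have card_I: "card I = DIM('a) * (2 * N ^ ?k)"
    proof -
      have "card I = (\<Sum>b\<in>(Basis::'a set). card ({L, - L} \<times> ((Basis - {b}) \<rightarrow>\<^sub>E {..<N})))"
        unfolding I_def by (rule card_SigmaI) (auto intro!: finite_cartesian_product finite_PiE)
      also have "\<dots> = (\<Sum>b\<in>(Basis::'a set). 2 * N ^ ?k)"
        using L by (intro sum.cong) (auto simp: card_cartesian_product card_PiE card_Diff_singleton)
      finally show ?thesis by simp
    qed
    have dist_E: "dist x y \<le> ?n * h" if "i \<in> I" "x \<in> E i" "y \<in> E i" for i x y
    proof -
      obtain b s g where i: "i = (b, s, g)" by (cases i)
      have "\<bar>(x - y) \<bullet> c\<bar> \<le> h" if c: "c \<in> Basis" for c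
      proof (cases "c = b")
        case True
        then show ?thesis using \<open>x \<in> E i\<close> \<open>y \<in> E i\<close> h by (auto simp: i E_def inner_diff_left)
      next
        case False
        then have "real (g c) * h - L \<le> x \<bullet> c" "x \<bullet> c \<le> real (g c) * h + h - L"
          "real (g c) * h - L \<le> y \<bullet> c" "y \<bullet> c \<le> real (g c) * h + h - L"
          using \<open>x \<in> E i\<close> \<open>y \<in> E i\<close> c by (auto simp: i E_def distrib_right)
        then show ?thesis by (simp add: inner_diff_left abs_le_iff)
      qed
      then have "(\<Sum>c\<in>Basis. \<bar>(x - y) \<bullet> c\<bar>) \<le> of_nat (card (Basis::'a set)) * h"
        by (rule sum_bounded_above)
      then show ?thesis using norm_le_l1[of "x - y"] by (simp add: dist_norm)
    qed
    have bdE: "bounded (E i)" if "i \<in> I" for i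
      using dist_E[OF that] unfolding bounded_two_points by blast
    have nh: "0 \<le> ?n * h" using h by simp
    have diamE: "diameter (E i) \<le> ?n * h" if "i \<in> I" for i
      by (rule diameter_le) (use dist_E[OF that] nh in \<open>auto simp: dist_norm\<close>)
    have cover: "frontier ?D \<subseteq> (\<Union>i\<in>I. E i)"
    proof
      fix x assume "x \<in> frontier ?D"
      then have x: "x \<in> ?D" "x \<notin> box (- (L *\<^sub>R One)) (L *\<^sub>R One)" by (auto simp: frontier_cbox)
      then have xb: "- L \<le> x \<bullet> c" "x \<bullet> c \<le> L" if "c \<in> Basis" for c
        using that by (auto simp: mem_box)
      obtain b where b: "b \<in> Basis" "x \<bullet> b = L \<or> x \<bullet> b = - L"
        using x(2) xb by (force simp: mem_box)
      have "\<exists>m. m < N \<and> real m * h - L \<le> x \<bullet> c \<and> x \<bullet> c \<le> (real m + 1) * h - L"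
        if c: "c \<in> Basis" for c
      proof -
        have "(x \<bullet> c + L) / h \<le> real N"
          using xb(2)[OF c] L N0 by (simp add: h_def divide_simps)
        moreover have "0 \<le> (x \<bullet> c + L) / h" using xb(1)[OF c] h by simp
        ultimately obtain m where "m < N" "real m \<le> (x \<bullet> c + L) / h" "(x \<bullet> c + L) / h \<le> real m + 1"
          using grid_index N0 by (metis of_nat_0_less_iff)
        then show ?thesis using h by (intro exI[of _ m]) (simp add: field_simps)
      qed
      then obtain g where g: "\<And>c. c \<in> Basis \<Longrightarrow>
          g c < N \<and> real (g c) * h - L \<le> x \<bullet> c \<and> x \<bullet> c \<le> (real (g c) + 1) * h - L"
        by metis
      have "(b, x \<bullet> b, restrict g (Basis - {b})) \<in> I"
        using b g by (auto simp: I_def)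
      moreover have "x \<in> E (b, x \<bullet> b, restrict g (Basis - {b}))"
        using g by (auto simp: E_def)
      ultimately show "x \<in> (\<Union>i\<in>I. E i)" by blast
    qed
    have "hausdorff_premeasure ?k \<delta> (frontier ?D) \<le> (\<Sum>i\<in>I. ennreal (hausdorff_gauge ?k (E i)))"
      using \<delta> h\<delta> by (intro hausdorff_premeasure_le_finite finI cover bdE order_trans[OF diamE]) auto
    also have "\<dots> \<le> of_nat (card I) * ennreal (v * (?n * h) ^ ?k)"
    proof (rule sum_bounded_above)
      fix i assume i: "i \<in> I"
      have "diameter (E i) ^ ?k \<le> (?n * h) ^ ?k"
        using diamE[OF i] bdE[OF i] by (intro power_mono diameter_ge_0)
      then have "hausdorff_gauge ?k (E i) \<le> v * (?n * h) ^ ?k"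
        unfolding gauge using v nh by (auto intro!: mult_left_mono)
      then show "ennreal (hausdorff_gauge ?k (E i)) \<le> ennreal (v * (?n * h) ^ ?k)"
        by (rule ennreal_leI)
    qed
    also have "\<dots> = ennreal (real (card I) * (v * (?n * h) ^ ?k))"
      using v nh by (simp add: ennreal_mult ennreal_of_nat_eq_real_of_nat)
    also have "real (card I) * (v * (?n * h) ^ ?k) = 2 * ?n * v * (?n * (2 * L)) ^ ?k"
      using N0 by (simp add: card_I h_def power_mult_distrib power_divide field_simps)
    finally show ?thesis unfolding C_def .
  qed
  then have "hausdorff_outer ?k (frontier ?D) \<le> C"
    unfolding hausdorff_outer_def by (intro SUP_least) simp
  also have "C < top" by (simp add: C_def)
  finally show ?thesis .
qed

lemma hausdorff_outer_frontier_finite: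
  fixes S :: "'a::euclidean_space set"
  assumes "convex S" "closed S" "interior S \<noteq> {}" "bounded S"
  shows "hausdorff_outer (DIM('a) - 1) (frontier S) < top"
proof -
  obtain L where L: "0 < L" "\<And>x. x \<in> S \<Longrightarrow> norm x \<le> L"
    using assms(4) bounded_pos by metis
  have "S \<subseteq> cbox (- (L *\<^sub>R One)) (L *\<^sub>R One)"
  proof
    fix x assume "x \<in> S"
    then have "\<bar>x \<bullet> b\<bar> \<le> L" if "b \<in> Basis" for b
      using L(2) that norm_bound_Basis_le by blast
    then show "x \<in> cbox (- (L *\<^sub>R One)) (L *\<^sub>R One)"
      by (force simp: mem_box abs_le_iff)
  qed
  then have "hausdorff_outer (DIM('a) - 1) (frontier S)
      \<le> hausdorff_outer (DIM('a) - 1) (frontier (cbox (- (L *\<^sub>R One)) (L *\<^sub>R One) :: 'a set))"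
    by (intro hausdorff_outer_frontier_mono assms bounded_cbox)
  also have "\<dots> < top" by (rule hausdorff_outer_frontier_cube[OF L(1)])
  finally show ?thesis .
qed

section \<open>The boundary of a domain has positive measure\<close>

text \<open>
  Suppose that the shadow of \<open>F\<close> along the axis \<open>j\<close> contains the shadow of \<open>S\<close>. A covering set
  of \<open>F\<close> of diameter \<open>d\<close> is then replaced by a box of side \<open>2 * d\<close> in the directions other than
  \<open>j\<close> and of fixed height \<open>2 * L\<close> in the direction \<open>j\<close>. These boxes cover \<open>S\<close>, and their volumes
  are a fixed multiple \<open>K\<close> of the \<open>(n - 1)\<close>-dimensional gauges. So if \<open>F\<close> were null, \<open>S\<close> would
  be Lebesgue-null.
\<close>
lemma hausdorff_outer_shadow_pos:
  fixes S F :: "'a::euclidean_space set"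
  assumes S: "open S" "S \<noteq> {}" "bounded S" and j: "j \<in> Basis"
    and shadow: "\<And>x. x \<in> S \<Longrightarrow> \<exists>y\<in>F. \<forall>c\<in>Basis - {j}. y \<bullet> c = x \<bullet> c"
  shows "0 < hausdorff_outer (DIM('a) - 1) F"
proof (rule ccontr)
  let ?k = "DIM('a) - 1"
  assume "\<not> 0 < hausdorff_outer ?k F"
  then have "hausdorff_outer ?k F = 0" by (simp add: zero_less_iff_neq_zero)
  then have pre0: "hausdorff_premeasure ?k 1 F = 0"
    using hausdorff_outer_ge[of 1 ?k F] by simp
  obtain L where L: "0 < L" "\<And>x. x \<in> S \<Longrightarrow> norm x \<le> L"
    using S(3) bounded_pos by metis
  define v where "v = unit_ball_vol (real ?k) / 2 ^ ?k"
  have v: "0 < v" by (simp add: v_def)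
  have gauge: "hausdorff_gauge ?k X = (if X = {} then 0 else v * diameter X ^ ?k)" for X :: "'a set"
    by (simp only: hausdorff_gauge_def v_def)
  define K where "K = 2 * L * 2 ^ ?k / v"
  have K: "0 < K" using L v by (simp add: K_def)
  have "emeasure lborel S \<le> 0 + ennreal e" if e: "0 < e" for e
  proof -
    have "hausdorff_premeasure ?k 1 F < ennreal (e / K)" using pre0 e K by simp
    then obtain E where E: "E \<in> hausdorff_covers 1 F"
      and sum_E: "(\<Sum>i. ennreal (hausdorff_gauge ?k (E i))) < ennreal (e / K)"
      unfolding hausdorff_premeasure_def INF_less_iff by blast
    have bd: "bounded (E i)" for i using E by (auto simp: hausdorff_covers_def)
    define p where "p i = (SOME y. y \<in> E i)" for i
    have p: "p i \<in> E i" if "E i \<noteq> {}" for i using that unfolding p_def by (simp add: some_in_eq)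
    define l where "l i = (\<Sum>c\<in>Basis. (if c = j then - L else p i \<bullet> c - diameter (E i)) *\<^sub>R c)" for i
    define u where "u i = (\<Sum>c\<in>Basis. (if c = j then L else p i \<bullet> c + diameter (E i)) *\<^sub>R c)" for i
    define Q where "Q i = (if E i = {} then {} else cbox (l i) (u i))" for i
    have Q_sets: "Q i \<in> sets lborel" for i by (simp add: Q_def)
    have SQ: "S \<subseteq> (\<Union>i. Q i)"
    proof
      fix x assume x: "x \<in> S"
      then obtain y where y: "y \<in> F" "\<forall>c\<in>Basis - {j}. y \<bullet> c = x \<bullet> c" using shadow by blast
      then obtain i where i: "y \<in> E i" using E by (auto simp: hausdorff_covers_def)
      have "\<bar>(y - p i) \<bullet> c\<bar> \<le> diameter (E i)" if c: "c \<in> Basis" for c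
        using norm_bound_Basis_le[OF c] diameter_bounded_bound[OF bd i p[of i]] i
        by (auto simp: dist_norm)
      then have "- diameter (E i) \<le> y \<bullet> c - p i \<bullet> c" "y \<bullet> c - p i \<bullet> c \<le> diameter (E i)"
        if "c \<in> Basis" for c
        using that by (auto simp: abs_le_iff inner_diff_left) (smt (verit))+
      moreover have "\<bar>x \<bullet> j\<bar> \<le> L" using norm_bound_Basis_le[OF j L(2)[OF x]] .
      ultimately have "x \<in> cbox (l i) (u i)"
        using y(2) by (force simp: mem_box l_def u_def abs_le_iff)
      then have "x \<in> Q i" using i by (auto simp: Q_def)
      then show "x \<in> (\<Union>i. Q i)" by blast
    qed
    have Q_le: "emeasure lborel (Q i) \<le> ennreal K * ennreal (hausdorff_gauge ?k (E i))" for i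
    proof (cases "E i = {}")
      case True
      then show ?thesis by (simp add: Q_def)
    next
      case False
      have d: "0 \<le> diameter (E i)" by (rule diameter_ge_0[OF bd])
      have "(\<Prod>c\<in>Basis. (u i - l i) \<bullet> c) = (\<Prod>c\<in>Basis. if c = j then 2 * L else 2 * diameter (E i))"
        by (intro prod.cong) (auto simp: u_def l_def inner_diff_left)
      also have "\<dots> = 2 * L * (\<Prod>c\<in>Basis - {j}. if c = j then 2 * L else 2 * diameter (E i))"
        using j by (subst prod.remove[of _ j]) auto
      also have "(\<Prod>c\<in>Basis - {j}. if c = j then 2 * L else 2 * diameter (E i))
          = (\<Prod>c\<in>Basis - {j}. 2 * diameter (E i))"
        by (intro prod.cong) auto
      also have "\<dots> = (2 * diameter (E i)) ^ ?k"
        using j by (simp add: card_Diff_singleton)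
      finally have "(\<Prod>c\<in>Basis. (u i - l i) \<bullet> c) = 2 * L * (2 * diameter (E i)) ^ ?k" .
      then have "emeasure lborel (Q i) \<le> ennreal (2 * L * (2 * diameter (E i)) ^ ?k)"
        using False by (simp add: Q_def emeasure_lborel_cbox_eq)
      also have "2 * L * (2 * diameter (E i)) ^ ?k = K * hausdorff_gauge ?k (E i)"
        unfolding gauge using False v by (simp add: K_def power_mult_distrib)
      also have "ennreal \<dots> = ennreal K * ennreal (hausdorff_gauge ?k (E i))"
        using K hausdorff_gauge_nonneg[OF bd] by (simp add: ennreal_mult)
      finally show ?thesis .
    qed
    have "emeasure lborel S \<le> emeasure lborel (\<Union>i. Q i)"
      by (intro emeasure_mono SQ sets.countable_UN) (use Q_sets in auto)
    also have "\<dots> \<le> (\<Sum>i. emeasure lborel (Q i))"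
      by (rule emeasure_subadditive_countably) (use Q_sets in auto)
    also have "\<dots> \<le> (\<Sum>i. ennreal K * ennreal (hausdorff_gauge ?k (E i)))"
      by (intro suminf_le Q_le) auto
    also have "\<dots> = ennreal K * (\<Sum>i. ennreal (hausdorff_gauge ?k (E i)))" by simp
    also have "\<dots> \<le> ennreal K * ennreal (e / K)"
      using sum_E by (intro mult_left_mono) auto
    also have "\<dots> = ennreal e" using K e by (simp flip: ennreal_mult)
    finally show ?thesis by simp
  qed
  then have "emeasure lborel S \<le> 0" by (rule ennreal_le_epsilon)
  then have "emeasure lebesgue S = 0" using S(1) by simp
  then have "negligible S" using S(1) by (simp add: negligible_iff_emeasure0)
  then show False using open_not_negligible S(1,2) by blast
qed

lemma hausdorff_outer_frontier_pos:
  fixes S :: "'a::euclidean_space set"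
  assumes "open S" "S \<noteq> {}" "bounded S"
  shows "0 < hausdorff_outer (DIM('a) - 1) (frontier S)"
proof -
  obtain j :: 'a where j: "j \<in> Basis" using nonempty_Basis by blast
  show ?thesis
  proof (rule hausdorff_outer_shadow_pos[OF assms j])
    fix x assume "x \<in> S"
    then obtain r where "x + r *\<^sub>R j \<in> frontier S"
      using ray_meets_frontier[OF assms(3)] j nonzero_Basis by blast
    moreover have "\<forall>c\<in>Basis - {j}. (x + r *\<^sub>R j) \<bullet> c = x \<bullet> c"
      using j by (auto simp: inner_add_left inner_Basis)
    ultimately show "\<exists>y\<in>frontier S. \<forall>c\<in>Basis - {j}. y \<bullet> c = x \<bullet> c" by blast
  qed
qed

section \<open>The measure of a cap of the boundary\<close>

lemma norm_orthogonal_part_le: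
  fixes v u :: "'a::real_inner"
  assumes "norm u = 1"
  shows "norm (v - (v \<bullet> u) *\<^sub>R u) \<le> norm v"
proof (rule power2_le_imp_le)
  have "u \<bullet> u = 1" using assms by (simp add: dot_square_norm)
  then have "(norm (v - (v \<bullet> u) *\<^sub>R u))\<^sup>2 = (norm v)\<^sup>2 - (v \<bullet> u)\<^sup>2"
    unfolding power2_norm_eq_inner by (simp add: algebra_simps inner_commute power2_eq_square)
  then show "(norm (v - (v \<bullet> u) *\<^sub>R u))\<^sup>2 \<le> (norm v)\<^sup>2" by simp
qed simp

text \<open>
  The outer normal at a boundary point \<open>y\<close> of \<open>S\<close> is also an outer normal of the contracted body
  \<open>A\<close> at \<open>z0 = T y\<close>. The ray from \<open>z0\<close> in this direction leaves \<open>S\<close> either above height \<open>s\<close>,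
  that is in the cap \<open>C\<close>, or it first crosses the hyperplane at height \<open>s\<close> inside \<open>S\<close>, at a point
  \<open>w\<close>; then going up from \<open>w\<close> one leaves \<open>S\<close> in \<open>C\<close>, so \<open>w\<close> is in the shadow \<open>R ` C\<close>. In both
  cases the point found is projected to \<open>z0\<close>. Neither the shadow map \<open>R\<close> nor the projection
  increases measure, which gives the factor 2.
\<close>
lemma hausdorff_outer_frontier_le_cap:
  fixes S :: "'a::euclidean_space set"
  assumes S: "convex S" "compact S" "interior S \<noteq> {}" and u: "norm u = 1"
    and p: "p \<in> S" and t: "0 < t" "t \<le> 1"
    and high: "\<And>x. x \<in> S \<Longrightarrow> s \<le> (p + t *\<^sub>R (x - p)) \<bullet> u"
  shows "ennreal (t ^ k) * hausdorff_outer k (frontier S)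
    \<le> 2 * hausdorff_outer k (frontier S \<inter> {x. s \<le> x \<bullet> u})"
proof -
  define T where "T x = p + t *\<^sub>R (x - p)" for x
  define A where "A = T ` S"
  define C where "C = frontier S \<inter> {x. s \<le> x \<bullet> u}"
  define R where "R x = x - (x \<bullet> u - s) *\<^sub>R u" for x
  have closed_S: "closed S" and bounded_S: "bounded S"
    using S(2) compact_imp_closed compact_imp_bounded by auto
  have front_S: "frontier S \<subseteq> S" using closed_S frontier_subset_closed by blast
  have u0: "u \<noteq> 0" using u by auto
  have T_alt: "T x = (1 - t) *\<^sub>R p + t *\<^sub>R x" for x by (simp add: T_def algebra_simps)
  have AS: "A \<subseteq> S"
    unfolding A_def T_alt using convexD_alt[OF S(1) p _ less_imp_le[OF t(1)] t(2)] by auto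
  have A: "convex A" "closed A" "A \<noteq> {}"
  proof -
    have "A = (\<lambda>x. (1 - t) *\<^sub>R p + t *\<^sub>R x) ` S" by (simp add: A_def T_alt)
    then show "convex A" using convex_affinity[OF S(1)] by simp
    have "compact A" unfolding A_def T_def
      by (intro compact_continuous_image S continuous_intros)
    then show "closed A" by (rule compact_imp_closed)
    show "A \<noteq> {}" using p by (auto simp: A_def)
  qed
  have cover: "T ` frontier S \<subseteq> closest_point A ` (C \<union> R ` C)"
  proof
    fix z0 assume "z0 \<in> T ` frontier S"
    then obtain y where y: "y \<in> frontier S" "z0 = T y" by blast
    obtain a where a: "a \<noteq> 0" "\<And>x. x \<in> S \<Longrightarrow> a \<bullet> x \<le> a \<bullet> y"
      using frontier_normal[OF S(1) closed_S y(1) S(3)] by metis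
    have z0: "z0 \<in> A" using y front_S by (auto simp: A_def)
    then have z0S: "z0 \<in> S" using AS by blast
    have normal: "a \<bullet> x \<le> a \<bullet> z0" if "x \<in> A" for x
      using that a(2) t(1) by (auto simp: A_def y(2) T_alt inner_add_right)
    have proj: "closest_point A (z0 + r *\<^sub>R a) = z0" if "0 \<le> r" for r
      by (rule closest_point_normal[OF A(1,2) z0 normal that])
    obtain r where r: "0 \<le> r" "z0 + r *\<^sub>R a \<in> frontier S"
      using ray_meets_frontier[OF bounded_S z0S a(1)] by blast
    define z where "z = z0 + r *\<^sub>R a"
    show "z0 \<in> closest_point A ` (C \<union> R ` C)"
    proof (cases "s \<le> z \<bullet> u")
      case True
      then have "z \<in> C" using r(2) by (simp add: C_def z_def)
      then show ?thesis using proj[OF r(1)] unfolding z_def by (metis UnI1 imageI)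
    next
      case False
      have s: "s \<le> z0 \<bullet> u" using high y front_S by (auto simp: T_def)
      define c where "c = (z0 \<bullet> u - s) / (z0 \<bullet> u - z \<bullet> u)"
      have c: "0 \<le> c" "c \<le> 1" "c * (z0 \<bullet> u - z \<bullet> u) = z0 \<bullet> u - s"
        using s False by (auto simp: c_def divide_simps)
      define w where "w = z0 + (c * r) *\<^sub>R a"
      have w: "w = (1 - c) *\<^sub>R z0 + c *\<^sub>R z" by (simp add: w_def z_def algebra_simps)
      have "w \<in> S"
        unfolding w using convexD_alt[OF S(1) z0S _ c(1,2)] r(2) front_S by (auto simp: z_def)
      then obtain \<rho> where \<rho>: "0 \<le> \<rho>" "w + \<rho> *\<^sub>R u \<in> frontier S"
        using ray_meets_frontier[OF bounded_S _ u0] by blast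
      have wu: "w \<bullet> u = s"
        using c(3) by (simp add: w inner_add_left algebra_simps)
      have uu: "u \<bullet> u = 1" using u by (simp add: dot_square_norm)
      have "w + \<rho> *\<^sub>R u \<in> C" using \<rho> wu uu by (simp add: C_def inner_add_left)
      moreover have "R (w + \<rho> *\<^sub>R u) = w" using wu uu by (simp add: R_def inner_add_left)
      moreover have "closest_point A w = z0" unfolding w_def using c r by (intro proj) simp
      ultimately show ?thesis by (metis UnI2 imageI)
    qed
  qed
  have T_inv: "(\<lambda>x. p + (1 / t) *\<^sub>R (x - p)) ` T ` frontier S = frontier S"
    using t(1) by (auto simp: T_def image_image)
  have "hausdorff_outer k (frontier S) \<le> ennreal ((1 / t) ^ k) * hausdorff_outer k (T ` frontier S)"
    by (subst T_inv[symmetric], rule hausdorff_outer_lipschitz_image)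
      (use t(1) in \<open>auto simp: dist_norm simp flip: scaleR_diff_right\<close>)
  also have "hausdorff_outer k (T ` frontier S) \<le> hausdorff_outer k (closest_point A ` (C \<union> R ` C))"
    by (rule hausdorff_outer_mono[OF cover])
  also have "\<dots> \<le> ennreal (1 ^ k) * hausdorff_outer k (C \<union> R ` C)"
    by (rule hausdorff_outer_lipschitz_image) (use closest_point_lipschitz[OF A] in auto)
  also have "\<dots> = hausdorff_outer k (C \<union> R ` C)" by simp
  also have "\<dots> \<le> hausdorff_outer k C + hausdorff_outer k (R ` C)" by (rule hausdorff_outer_Un)
  also have "hausdorff_outer k (R ` C) \<le> ennreal (1 ^ k) * hausdorff_outer k C"
  proof (rule hausdorff_outer_lipschitz_image)
    fix x y
    have "R x - R y = (x - y) - ((x - y) \<bullet> u) *\<^sub>R u" by (simp add: R_def algebra_simps)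
    then show "dist (R x) (R y) \<le> 1 * dist x y"
      using norm_orthogonal_part_le[OF u, of "x - y"] by (simp add: dist_norm)
  qed simp
  also have "hausdorff_outer k C + ennreal (1 ^ k) * hausdorff_outer k C = 2 * hausdorff_outer k C"
    by (simp add: mult_2)
  finally have le: "hausdorff_outer k (frontier S) \<le> ennreal ((1 / t) ^ k) * (2 * hausdorff_outer k C)"
    by (simp add: add_left_mono mult_left_mono)
  have "ennreal (t ^ k) * hausdorff_outer k (frontier S)
      \<le> ennreal (t ^ k) * (ennreal ((1 / t) ^ k) * (2 * hausdorff_outer k C))"
    using le by (rule mult_left_mono) simp
  also have "\<dots> = ennreal (t ^ k * (1 / t) ^ k) * (2 * hausdorff_outer k C)"
    using t(1) by (simp add: ennreal_mult mult.assoc)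
  also have "t ^ k * (1 / t) ^ k = 1" using t(1) by (simp flip: power_mult_distrib)
  finally show ?thesis by (simp add: C_def)
qed

section \<open>Centers of mass\<close>

lemma center_of_mass_inner:
  fixes S :: "'a::euclidean_space set"
  assumes "S \<in> sets borel" "bounded S" "emeasure (hausdorff_measure k) S < top"
  shows "set_integrable (hausdorff_measure k) S (\<lambda>x. x \<bullet> u)"
    and "center_of_mass k S \<bullet> u
      = (LINT x:S|hausdorff_measure k. x \<bullet> u) / measure (hausdorff_measure k) S"
proof -
  obtain B where B: "\<And>x. x \<in> S \<Longrightarrow> norm x \<le> B"
    using assms(2) by (auto simp: bounded_iff)
  have int: "integrable (hausdorff_measure k) (\<lambda>x. indicator S x *\<^sub>R x)"
    by (rule integrableI_bounded_set_indicator[of _ _ _ B]) (use assms B in auto)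
  have eq: "indicator S x *\<^sub>R (x \<bullet> u) = (indicator S x *\<^sub>R x) \<bullet> u" for x by simp
  show "set_integrable (hausdorff_measure k) S (\<lambda>x. x \<bullet> u)"
    unfolding set_integrable_def eq by (intro integrable_inner_left int)
  show "center_of_mass k S \<bullet> u
      = (LINT x:S|hausdorff_measure k. x \<bullet> u) / measure (hausdorff_measure k) S"
    unfolding center_of_mass_def set_lebesgue_integral_def eq
    by (subst integral_inner_left) (use int in auto)
qed

lemma center_of_mass_inner_le:
  fixes S :: "'a::euclidean_space set"
  assumes S: "S \<in> sets borel" "bounded S" and B: "0 \<le> B" "\<And>x. x \<in> S \<Longrightarrow> x \<bullet> u \<le> B"
  shows "center_of_mass k S \<bullet> u \<le> B"
proof (cases "measure (hausdorff_measure k) S = 0")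
  case True
  \<comment> \<open>The measure is zero or infinite; the quotient is then \<open>0\<close> by convention.\<close>
  then show ?thesis using B(1) by (simp add: center_of_mass_def)
next
  case False
  then have fin: "emeasure (hausdorff_measure k) S < top"
    by (metis enn2real_top measure_def less_top)
  have pos: "0 < measure (hausdorff_measure k) S" using False by (simp add: zero_less_measure_iff)
  have "(LINT x:S|hausdorff_measure k. x \<bullet> u) \<le> (LINT x:S|hausdorff_measure k. B)"
    using S fin by (intro set_integral_mono center_of_mass_inner B(2))
      (auto simp: set_integrable_def)
  also have "\<dots> = measure (hausdorff_measure k) S * B"
    using S fin by (simp add: set_lebesgue_integral_def)
  finally show ?thesis
    using center_of_mass_inner(2)[OF S fin, of u] pos by (simp add: pos_divide_le_eq mult.commute)
qed

lemma center_of_mass_inner_ge: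
  fixes S :: "'a::euclidean_space set"
  assumes S: "S \<in> sets borel" "bounded S" and fin: "emeasure (hausdorff_measure k) S < top"
    and C: "C \<in> sets borel" "C \<subseteq> S" and nonneg: "\<And>x. x \<in> S \<Longrightarrow> 0 \<le> x \<bullet> u"
    and s: "\<And>x. x \<in> C \<Longrightarrow> s \<le> x \<bullet> u"
  shows "s * measure (hausdorff_measure k) C / measure (hausdorff_measure k) S
    \<le> center_of_mass k S \<bullet> u"
proof -
  have finC: "emeasure (hausdorff_measure k) C < top"
    using emeasure_mono[OF C(2), of "hausdorff_measure k"] S(1) fin by (simp add: le_less_trans)
  have "s * measure (hausdorff_measure k) C = (\<integral>x. indicator C x *\<^sub>R s \<partial>hausdorff_measure k)"
    using C finC by simp
  also have "\<dots> \<le> (\<integral>x. indicator S x *\<^sub>R (x \<bullet> u) \<partial>hausdorff_measure k)"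
  proof (rule integral_mono)
    show "integrable (hausdorff_measure k) (\<lambda>x. indicator C x *\<^sub>R s)"
      using C finC by simp
    show "integrable (hausdorff_measure k) (\<lambda>x. indicator S x *\<^sub>R (x \<bullet> u))"
      using center_of_mass_inner(1)[OF S fin] by (simp add: set_integrable_def)
    show "indicator C x *\<^sub>R s \<le> indicator S x *\<^sub>R (x \<bullet> u)" for x
      using C(2) nonneg s by (auto simp: indicator_def)
  qed
  finally show ?thesis
    unfolding center_of_mass_inner(2)[OF S fin] set_lebesgue_integral_def
    by (rule divide_right_mono) simp
qed

lemma distr_hausdorff_measure_point_reflection:
  fixes c :: "'a::euclidean_space"
  shows "distr (hausdorff_measure k) (hausdorff_measure k) (\<lambda>x. c - x) = hausdorff_measure k"
proof (rule measure_eqI)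
  fix A assume "A \<in> sets (distr (hausdorff_measure k) (hausdorff_measure k) (\<lambda>x. c - x))"
  then have A: "A \<in> sets borel" by simp
  have le: "hausdorff_outer k ((\<lambda>x. c - x) ` X) \<le> hausdorff_outer k X" for X
    using hausdorff_outer_lipschitz_image[of 1 X "\<lambda>x. c - x" k] by (simp add: dist_norm norm_minus_commute)
  have "x \<in> (\<lambda>x. c - x) ` A" if "c - x \<in> A" for x
    using imageI[OF that, of "\<lambda>x. c - x"] by simp
  then have vi: "(\<lambda>x. c - x) -` A = (\<lambda>x. c - x) ` A" by auto
  have "(\<lambda>x. c - x) ` (\<lambda>x. c - x) ` A = A" by (simp add: image_image)
  then have "hausdorff_outer k ((\<lambda>x. c - x) ` A) = hausdorff_outer k A"
    using le[of A] le[of "(\<lambda>x. c - x) ` A"] by simp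
  moreover have "(\<lambda>x. c - x) -` A \<in> sets borel"
    using measurable_sets_borel[of "\<lambda>x. c - x" borel A] A by simp
  ultimately show "emeasure (distr (hausdorff_measure k) (hausdorff_measure k) (\<lambda>x. c - x)) A
      = emeasure (hausdorff_measure k) A"
    using A by (subst emeasure_distr) (auto simp: emeasure_hausdorff_measure vi)
qed simp

text \<open>
  The map \<open>x \<mapsto> c - x\<close> is the reflection in the point \<open>c / 2\<close>; it preserves Hausdorff measure,
  so the integral \<open>I\<close> of \<open>x\<close> over \<open>S\<close> satisfies \<open>I = measure S *\<^sub>R c - I\<close>.
\<close>
lemma center_of_mass_symmetric:
  fixes S :: "'a::euclidean_space set"
  assumes S: "S \<in> sets borel" "bounded S" and sym: "\<And>x. x \<in> S \<Longrightarrow> c - x \<in> S"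
    and nz: "measure (hausdorff_measure k) S \<noteq> 0"
  shows "center_of_mass k S = (1 / 2) *\<^sub>R c"
proof -
  let ?M = "hausdorff_measure k :: 'a measure"
  have fin: "emeasure ?M S < top" using nz by (metis enn2real_top measure_def less_top)
  obtain B where B: "\<And>x. x \<in> S \<Longrightarrow> norm x \<le> B"
    using S(2) by (auto simp: bounded_iff)
  have int: "integrable ?M (\<lambda>x. indicator S x *\<^sub>R x)"
    by (rule integrableI_bounded_set_indicator[of _ _ _ B]) (use S fin B in auto)
  have intc: "integrable ?M (\<lambda>x. indicator S x *\<^sub>R c)"
    using S fin by simp
  have ind: "indicator S (c - x) = (indicator S x :: real)" for x
    using sym[of x] sym[of "c - x"] by (auto simp: indicator_def)
  let ?I = "\<integral>x. indicator S x *\<^sub>R x \<partial>?M"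
  have "?I = (\<integral>x. indicator S x *\<^sub>R x \<partial>distr ?M ?M (\<lambda>x. c - x))"
    by (simp only: distr_hausdorff_measure_point_reflection)
  also have "\<dots> = (\<integral>x. indicator S (c - x) *\<^sub>R (c - x) \<partial>?M)"
    by (rule integral_distr) (use S in auto)
  also have "\<dots> = (\<integral>x. indicator S x *\<^sub>R c - indicator S x *\<^sub>R x \<partial>?M)"
    by (simp add: ind scaleR_diff_right)
  also have "\<dots> = measure ?M S *\<^sub>R c - ?I"
    using int intc S fin by (simp add: Bochner_Integration.integral_diff)
  finally have "?I + ?I = measure ?M S *\<^sub>R c"
    by (simp only: eq_diff_eq)
  then have "(1 / 2) *\<^sub>R (?I + ?I) = (1 / 2) *\<^sub>R (measure ?M S *\<^sub>R c)"
    by (rule arg_cong)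
  then have "?I = (measure ?M S / 2) *\<^sub>R c"
    by (simp only: scaleR_half_double) simp
  then show ?thesis using nz
    by (simp add: center_of_mass_def set_lebesgue_integral_def)
qed

section \<open>Comparison of the two centers of mass\<close>

lemma one_dimensional_convex_body:
  fixes S :: "'a::euclidean_space set"
  assumes S: "convex S" "compact S" "S \<noteq> {}" and dim: "DIM('a) = 1"
  obtains a b where "S = cbox a b"
proof -
  obtain e :: 'a where e: "Basis = {e}" using dim card_1_singletonE by blast
  have cont: "continuous_on S (\<lambda>x. x \<bullet> e)" by (intro continuous_intros)
  obtain a where a: "a \<in> S" "\<And>x. x \<in> S \<Longrightarrow> a \<bullet> e \<le> x \<bullet> e"
    using continuous_attains_inf[OF S(2,3) cont] by blast
  obtain b where b: "b \<in> S" "\<And>x. x \<in> S \<Longrightarrow> x \<bullet> e \<le> b \<bullet> e"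
    using continuous_attains_sup[OF S(2,3) cont] by blast
  have "x \<in> S" if x: "a \<bullet> e \<le> x \<bullet> e" "x \<bullet> e \<le> b \<bullet> e" for x
  proof -
    obtain y where "y \<in> S" "y \<bullet> e = x \<bullet> e"
      using connected_ivt_component[OF convex_connected[OF S(1)] a(1) b(1) x] by blast
    moreover have "y = x" by (rule euclidean_eqI) (use e \<open>y \<bullet> e = x \<bullet> e\<close> in auto)
    ultimately show ?thesis by simp
  qed
  then have "S = cbox a b" using a(2) b(2) by (auto simp: mem_box e)
  then show ?thesis by (rule that)
qed

text \<open>
  An interval and its boundary are symmetric about the midpoint, so the two centers agree for every
  order \<open>k\<close> for which \<open>\<Omega>\<close> has finite positive measure; otherwise the left-hand side is \<open>0\<close> by
  convention.
\<close>
lemma center_of_mass_domain_1dim: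
  fixes \<Omega> :: "'a::euclidean_space set"
  assumes \<Omega>: "open \<Omega>" "\<Omega> \<noteq> {}" "bounded \<Omega>" "convex \<Omega>" and dim: "DIM('a) = 1"
  shows "norm (center_of_mass k \<Omega>) \<le> norm (center_of_mass 0 (frontier \<Omega>))"
proof -
  have int: "interior (closure \<Omega>) = \<Omega>"
    using convex_interior_closure[OF \<Omega>(4)] \<Omega>(1) by (simp add: interior_open)
  obtain a b where ab: "closure \<Omega> = cbox a b"
    using one_dimensional_convex_body[of "closure \<Omega>"] \<Omega> dim by (auto simp: compact_closure)
  have box: "\<Omega> = box a b" using int by (simp add: ab)
  have front: "frontier \<Omega> = cbox a b - box a b"
    using \<Omega>(2) frontier_box[of a b] by (simp add: box)
  have outer: "0 < hausdorff_outer 0 (frontier \<Omega>)" "hausdorff_outer 0 (frontier \<Omega>) < top"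
    using hausdorff_outer_frontier_pos[OF \<Omega>(1-3)]
      hausdorff_outer_frontier_finite[of "closure \<Omega>"] \<Omega> dim int
    by (auto simp: frontier_def interior_open)
  then have "measure (hausdorff_measure 0) (frontier \<Omega>) \<noteq> 0"
    by (auto simp: measure_def emeasure_hausdorff_measure enn2real_eq_0_iff)
  then have "center_of_mass 0 (frontier \<Omega>) = (1 / 2) *\<^sub>R (a + b)"
    by (intro center_of_mass_symmetric) (auto simp: front mem_box algebra_simps intro!: bounded_diff)
  moreover have "center_of_mass k \<Omega> = (1 / 2) *\<^sub>R (a + b)"
    if "measure (hausdorff_measure k) \<Omega> \<noteq> 0"
    using \<Omega>(1,3) that by (intro center_of_mass_symmetric) (auto simp: box mem_box algebra_simps)
  moreover have "center_of_mass k \<Omega> = 0" if "measure (hausdorff_measure k) \<Omega> = 0"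
    using that by (simp add: center_of_mass_def)
  ultimately show ?thesis by (cases "measure (hausdorff_measure k) \<Omega> = 0") simp_all
qed

lemma center_of_mass_component_le:
  fixes \<Omega> :: "'a::euclidean_space set"
  assumes \<Omega>: "open \<Omega>" "\<Omega> \<noteq> {}" "bounded \<Omega>" "convex \<Omega>" and u: "norm u = 1"
    and nonneg: "\<And>x. x \<in> \<Omega> \<Longrightarrow> 0 \<le> x \<bullet> u" and t: "0 < t" "t < 1"
  defines "k \<equiv> DIM('a) - 1"
  shows "(1 - t) * t ^ k / 2 * (center_of_mass j \<Omega> \<bullet> u) \<le> center_of_mass k (frontier \<Omega>) \<bullet> u"
proof -
  let ?S = "closure \<Omega>" and ?F = "frontier \<Omega>" and ?M = "hausdorff_measure k :: 'a measure"
  have S: "convex ?S" "compact ?S" "?S \<noteq> {}" "interior ?S \<noteq> {}"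
    using \<Omega> convex_interior_closure[OF \<Omega>(4)]
    by (auto simp: compact_closure convex_closure interior_open)
  have front: "frontier ?S = ?F" using \<Omega>(1) convex_interior_closure[OF \<Omega>(4)]
    by (simp add: frontier_def)
  have nonneg_S: "0 \<le> x \<bullet> u" if "x \<in> ?S" for x
    by (rule continuous_ge_on_closure[OF _ that nonneg]) (intro continuous_intros)
  obtain p where p: "p \<in> ?S" "\<And>x. x \<in> ?S \<Longrightarrow> x \<bullet> u \<le> p \<bullet> u"
    using continuous_attains_sup[OF S(2,3) continuous_on_inner[OF continuous_on_id continuous_on_const]]
    by blast
  define B where "B = p \<bullet> u"
  have B: "0 \<le> B" using nonneg_S p(1) by (simp add: B_def)
  define C where "C = ?F \<inter> {x. (1 - t) * B \<le> x \<bullet> u}"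
  have C: "C \<in> sets borel" unfolding C_def
    by (intro borel_closed closed_Int frontier_closed closed_Collect_le continuous_intros)
  have F: "?F \<in> sets borel" "bounded ?F"
    using \<Omega>(3) by (simp_all add: compact_imp_bounded compact_frontier_bounded)
  have F_S: "?F \<subseteq> ?S" by (auto simp: frontier_def)
  have fin: "emeasure ?M ?F < top"
    using hausdorff_outer_frontier_finite[of ?S] S bounded_closure[OF \<Omega>(3)] F(1)
    by (simp add: emeasure_hausdorff_measure k_def front)
  have "0 < emeasure ?M ?F"
    using hausdorff_outer_frontier_pos[OF \<Omega>(1-3)] F(1) by (simp add: emeasure_hausdorff_measure k_def)
  then have pos: "0 < measure ?M ?F" using fin by (simp add: measure_def enn2real_positive_iff)
  have finC: "emeasure ?M C < top"
    using emeasure_mono[of C ?F ?M] F(1) fin by (simp add: C_def le_less_trans)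
  have "ennreal (t ^ k) * emeasure ?M ?F \<le> 2 * emeasure ?M C"
  proof -
    have "ennreal (t ^ k) * hausdorff_outer k (frontier ?S)
      \<le> 2 * hausdorff_outer k (frontier ?S \<inter> {x. (1 - t) * B \<le> x \<bullet> u})"
    proof (rule hausdorff_outer_frontier_le_cap[OF S(1,2,4) u p(1) t(1) less_imp_le[OF t(2)]])
      fix x assume "x \<in> ?S"
      then have "0 \<le> t * (x \<bullet> u)" using nonneg_S t(1) by simp
      then show "(1 - t) * B \<le> (p + t *\<^sub>R (x - p)) \<bullet> u"
        by (simp add: B_def algebra_simps)
    qed
    then show ?thesis using F(1) C by (simp add: emeasure_hausdorff_measure front C_def)
  qed
  then have "ennreal (t ^ k * measure ?M ?F) \<le> ennreal (2 * measure ?M C)"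
    using fin finC t(1) by (simp add: emeasure_eq_ennreal_measure ennreal_mult less_top)
  then have cap: "t ^ k * measure ?M ?F \<le> 2 * measure ?M C" by simp
  have "(1 - t) * t ^ k / 2 * (center_of_mass j \<Omega> \<bullet> u) \<le> (1 - t) * t ^ k / 2 * B"
  proof (rule mult_left_mono)
    show "center_of_mass j \<Omega> \<bullet> u \<le> B"
      using \<Omega>(1,3) B p(2) closure_subset[of \<Omega>]
      by (intro center_of_mass_inner_le) (auto simp: B_def)
  qed (use t in simp)
  also have "\<dots> = (1 - t) * B * (t ^ k * measure ?M ?F) / (2 * measure ?M ?F)"
    using pos by simp
  also have "\<dots> \<le> (1 - t) * B * (2 * measure ?M C) / (2 * measure ?M ?F)"
    using cap t B pos by (intro divide_right_mono mult_left_mono) auto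
  also have "\<dots> = (1 - t) * B * measure ?M C / measure ?M ?F" by simp
  also have "\<dots> \<le> center_of_mass k ?F \<bullet> u"
    using F fin C nonneg_S F_S by (intro center_of_mass_inner_ge) (auto simp: C_def)
  finally show ?thesis .
qed

lemma sqrt_pi_le_2: "sqrt pi \<le> 2"
proof -
  have "sqrt pi \<le> sqrt (2\<^sup>2)" using pi_less_4 by (subst real_sqrt_le_iff) simp
  then show ?thesis by simp
qed

text \<open>
  At \<open>t = k / n\<close>, where \<open>(1 - t) * t ^ k\<close> is largest, the right-hand side equals
  \<open>n * k ^ k / sqrt pi\<close>, and \<open>n \<ge> 2 \<ge> sqrt pi\<close>.
\<close>
lemma cap_constant:
  assumes "2 \<le> n"
  defines "k \<equiv> n - 1"
  defines "t \<equiv> real k / real n"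
  shows "1 \<le> 2 * real n ^ (n + 1) / sqrt pi * ((1 - t) * t ^ k / 2)"
proof -
  have k: "1 \<le> k" "n = Suc k" using assms by auto
  have "sqrt pi \<le> 2" by (rule sqrt_pi_le_2)
  also have "\<dots> \<le> real n * 1" using assms(1) by simp
  also have "\<dots> \<le> real n * real k ^ k" using k(1) by (intro mult_left_mono one_le_power) auto
  also have "\<dots> = 2 * real n ^ (n + 1) * ((1 - t) * t ^ k / 2)"
  proof -
    have "1 - t = 1 / real n" using k by (simp add: t_def field_simps)
    moreover have "t ^ k = real k ^ k / real n ^ k" by (simp add: t_def power_divide)
    ultimately show ?thesis using k(2) by simp
  qed
  finally show ?thesis by (simp add: divide_simps)
qed

theorem mainTheorem3:
  fixes \<Omega> :: "(real ^ 'n) set"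
  assumes "open \<Omega>" and "connected \<Omega>" and "\<Omega> \<noteq> {}"
    and "\<Omega> \<subseteq> {x. \<forall>i. 0 \<le> x $ i}"
    and "bounded \<Omega>" and "convex \<Omega>"
  shows "norm (center_of_mass CARD('n) \<Omega>)
           \<le> 2 * real CARD('n) ^ (CARD('n) + 1) / sqrt pi
               * norm (center_of_mass (CARD('n) - 1) (frontier \<Omega>))"
proof (cases "CARD('n) = 1")
  case True
  have "1 \<le> 2 / sqrt pi" using sqrt_pi_le_2 by simp
  then have "norm (center_of_mass 0 (frontier \<Omega>))
      \<le> 2 / sqrt pi * norm (center_of_mass 0 (frontier \<Omega>))"
    using mult_right_mono[of 1 "2 / sqrt pi", OF _ norm_ge_zero] by simp
  then show ?thesis
    using center_of_mass_domain_1dim[of \<Omega> 1] assms True by simp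
next
  case False
  let ?n = "CARD('n)" and ?m = "center_of_mass CARD('n) \<Omega>"
    and ?m' = "center_of_mass (CARD('n) - 1) (frontier \<Omega>)"
  have n: "2 \<le> ?n" using False zero_less_card_finite[where ?'a = 'n] by linarith
  define t where "t = real (?n - 1) / real ?n"
  define K where "K = 2 * real ?n ^ (?n + 1) / sqrt pi"
  have t: "0 < t" "t < 1" using n by (auto simp: t_def divide_simps)
  have K: "0 \<le> K" by (simp add: K_def)
  have K1: "1 \<le> K * ((1 - t) * t ^ (?n - 1) / 2)"
    unfolding K_def t_def by (rule cap_constant[OF n])
  have "norm ?m \<le> norm (K *\<^sub>R ?m')"
  proof (rule norm_le_componentwise_cart)
    fix i
    let ?u = "axis i 1 :: real ^ 'n"
    have comp: "x $ i = x \<bullet> ?u" for x :: "real ^ 'n" by (simp add: inner_axis)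
    have nonneg: "0 \<le> x \<bullet> ?u" if "x \<in> \<Omega>" for x
      using assms(4) that unfolding comp[symmetric] by blast
    have "?m \<bullet> (- ?u) \<le> 0"
      using assms(1,5) nonneg by (intro center_of_mass_inner_le) auto
    then have m: "0 \<le> ?m \<bullet> ?u" by simp
    have cap: "(1 - t) * t ^ (?n - 1) / 2 * (?m \<bullet> ?u) \<le> ?m' \<bullet> ?u"
      using center_of_mass_component_le[OF assms(1,3,5,6) _ nonneg t, where j = ?n] by simp
    have "?m \<bullet> ?u \<le> K * ((1 - t) * t ^ (?n - 1) / 2) * (?m \<bullet> ?u)"
      using mult_right_mono[OF K1 m] by simp
    also have "\<dots> = K * ((1 - t) * t ^ (?n - 1) / 2 * (?m \<bullet> ?u))" by (simp only: mult.assoc)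
    also have "\<dots> \<le> K * (?m' \<bullet> ?u)" using cap K by (rule mult_left_mono)
    finally have "?m $ i \<le> (K *\<^sub>R ?m') $ i" by (simp only: comp inner_scaleR_left)
    moreover have "0 \<le> ?m $ i" using m by (simp only: comp)
    ultimately show "norm (?m $ i) \<le> norm ((K *\<^sub>R ?m') $ i)" by simp
  qed
  then show ?thesis using K by (simp add: K_def)
qed

end
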